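(* Let $\mathcal{A}$ be a complex Banach algebra with unit $1$, let $a\in\mathcal{A}$ and let $n\in\mathbb{N}$. Then $a$ is generalized $n$-strongly Drazin invertible if and only if $a^n-a^{2n}\in\mathcal{A}^{qnil}$.
   Context: $\mathbb{N}$ is the set of positive integers. $\mathcal{A}^{qnil}=\{a\in\mathcal{A}:\lim_{m\to\infty}\|a^m\|^{1/m}=0\}=\{a\in\mathcal{A}:\sigma(a)=\{0\}\}$ is the set of quasinilpotent elements. $\mathrm{Comm}(a)=\{x\in\mathcal{A}:xa=ax\}$ and $\mathrm{Comm}^2(a)=\{x\in\mathcal{A}: xy=yx \text{ for all } y\in\mathrm{Comm}(a)\}$. An element $a\in\mathcal{A}$ is generalized $n$-strongly Drazin invertible (g$n$s-Drazin invertible) if there exists $x\in\mathcal{A}$ such that $x\in\mathrm{Comm}^2(a)$, $xax=x$ and $a^n-ax\in\mathcal{A}^{qnil}$. *)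

theory Defs
  imports "HOL-Analysis.Analysis"
begin

text \<open>
  Complex unital Banach algebras, as a class on top of the real ones. The norm is submultiplicative
  and complete; \<^prop>\<open>norm 1 = 1\<close> is not required. As \<^class>\<open>ring_1\<close> includes
  \<^prop>\<open>(0::'a::ring_1) \<noteq> 1\<close>, the zero algebra is excluded.
\<close>

class complex_banach_algebra_1 = real_normed_algebra + ring_1 + banach +
  fixes scaleC :: "complex \<Rightarrow> 'a \<Rightarrow> 'a"  (infixr \<open>*\<^sub>C\<close> 75)
  assumes scaleC_add_right: "c *\<^sub>C (x + y) = c *\<^sub>C x + c *\<^sub>C y"
    and scaleC_add_left: "(c + d) *\<^sub>C x = c *\<^sub>C x + d *\<^sub>C x"
    and scaleC_scaleC: "c *\<^sub>C (d *\<^sub>C x) = (c * d) *\<^sub>C x"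
    and scaleR_scaleC: "r *\<^sub>R x = complex_of_real r *\<^sub>C x"
    and mult_scaleC_left: "(c *\<^sub>C x) * y = c *\<^sub>C (x * y)"
    and mult_scaleC_right: "x * (c *\<^sub>C y) = c *\<^sub>C (x * y)"
    and norm_scaleC: "norm (c *\<^sub>C x) = cmod c * norm x"

instantiation complex :: complex_banach_algebra_1
begin

definition scaleC_complex :: "complex \<Rightarrow> complex \<Rightarrow> complex"
  where "scaleC_complex c x = c * x"

instance
  by standard (simp_all add: scaleC_complex_def algebra_simps norm_mult scaleR_conv_of_real)

end

definition quasinilpotents :: "'a::complex_banach_algebra_1 set"
  where "quasinilpotents = {a. (\<lambda>m. root m (norm (a ^ m))) \<longlonglongrightarrow> 0}"

definition Comm :: "'a::complex_banach_algebra_1 \<Rightarrow> 'a set"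
  where "Comm a = {x. x * a = a * x}"

definition Comm2 :: "'a::complex_banach_algebra_1 \<Rightarrow> 'a set"
  where "Comm2 a = {x. \<forall>y\<in>Comm a. x * y = y * x}"

definition gns_Drazin_invertible :: "nat \<Rightarrow> 'a::complex_banach_algebra_1 \<Rightarrow> bool"
  where "gns_Drazin_invertible n a \<longleftrightarrow>
    (\<exists>x. x \<in> Comm2 a \<and> x * a * x = x \<and> a ^ n - a * x \<in> quasinilpotents)"

end

theory Submission
  imports Defs
begin

text \<open>
  A quasinilpotent element \<open>q\<close> stays quasinilpotent after multiplication by anything that commutes
  with it (lemma \<open>quasinilpotents_mult_commuting\<close>). This settles the forward direction: if \<open>x\<close> is
  a g\<open>n\<close>s-Drazin inverse of \<open>a\<close>, then \<open>p = a * x\<close> is an idempotent that commutes with the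
  quasinilpotent \<open>q = a ^ n - p\<close>, and expanding \<open>a ^ n = p + q\<close> gives
  \<open>a ^ n - a ^ (2 * n) = q * (1 - 2 * p - q)\<close>.

  For the converse, put \<open>b = a ^ n\<close>. If \<open>b - b\<^sup>2\<close> is quasinilpotent, an idempotent \<open>p\<close> close to \<open>b\<close>
  is given by an explicit formula. Idempotents \<open>p\<close> correspond to involutions \<open>2 p - 1\<close>, and
  \<open>u = 2 b - 1\<close> is nearly an involution, as \<open>u\<^sup>2 = 1 + y\<close> with \<open>y = - 4 (b - b\<^sup>2)\<close>
  quasinilpotent. Hence \<open>u\<close> need only be divided by the square root of \<open>1 + y\<close>. The binomial series
  of \<open>(1 + y) powr (- 1 / 2)\<close> has bounded coefficients, so it converges at every quasinilpotent \<open>y\<close>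
  (lemma \<open>quasinilpotent_inverse_sqrt\<close>); its sum is \<open>1\<close> plus a multiple of \<open>y\<close>, which is why
  \<open>p - b\<close> is quasinilpotent (lemma \<open>idempotent_near_quasinilpotent_idempotent\<close>). The sum of such a
  series commutes with everything that \<open>y\<close> commutes with, and this yields the double commutant
  condition.

  Finally, \<open>1 + (b - p)\<close> has an inverse \<open>v\<close>, because \<open>b - p\<close> is quasinilpotent, and on the corner
  cut out by \<open>p\<close> it agrees with \<open>b\<close>: \<open>(1 + (b - p)) * p = b * p\<close>. So \<open>v * p\<close> inverts \<open>b\<close> on
  that corner, and \<open>x = a ^ (n - 1) * v * p\<close> satisfies \<open>a * x = p\<close>, from which all conditions on \<open>x\<close>
  follow.
\<close>

section \<open>Products of commuting elements and quasinilpotents\<close>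

lemma power_mult_of_commuting:
  fixes x y :: "'a::monoid_mult"
  assumes "x * y = y * x"
  shows "(x * y) ^ m = x ^ m * y ^ m"
proof (induction m)
  case (Suc m)
  have "(x * y) ^ Suc m = x * (y * x ^ m) * y ^ m"
    by (simp add: Suc.IH mult.assoc)
  also have "y * x ^ m = x ^ m * y"
    using power_commuting_commutes[OF assms, of m] by simp
  finally show ?case
    by (simp add: mult.assoc)
qed simp

lemma commutes_with_mult:
  fixes z :: "'a::semigroup_mult"
  assumes "z * x = x * z" and "z * y = y * z"
  shows "z * (x * y) = x * y * z"
  by (metis assms mult.assoc)

text \<open>The exponent \<open>0\<close> is excluded because \<open>norm 1\<close> may exceed \<open>1\<close>.\<close>

lemma norm_power_le:
  fixes c :: "'a::complex_banach_algebra_1"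
  shows "m \<ge> 1 \<Longrightarrow> norm (c ^ m) \<le> norm c ^ m"
proof (induction m rule: dec_induct)
  case (step m)
  have "norm (c ^ Suc m) \<le> norm c * norm (c ^ m)"
    by (simp add: norm_mult_ineq)
  also have "\<dots> \<le> norm c * norm c ^ m"
    using step.IH by (rule mult_left_mono) simp
  finally show ?case by simp
qed simp

text \<open>
  By commutation \<open>norm ((q * c) ^ m) \<le> norm (q ^ m) * norm c ^ m\<close>, so taking \<open>m\<close>-th roots costs only
  the constant factor \<open>norm c\<close>.
\<close>

lemma quasinilpotents_mult_commuting:
  fixes q c :: "'a::complex_banach_algebra_1"
  assumes q: "q \<in> quasinilpotents" and comm: "q * c = c * q"
  shows "q * c \<in> quasinilpotents"
proof -
  have bound: "root m (norm ((q * c) ^ m)) \<le> root m (norm (q ^ m)) * norm c" if "m \<ge> 1" for m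
  proof -
    have "norm ((q * c) ^ m) \<le> norm (q ^ m) * norm (c ^ m)"
      by (simp add: power_mult_of_commuting[OF comm] norm_mult_ineq)
    also have "\<dots> \<le> norm (q ^ m) * norm c ^ m"
      by (intro mult_left_mono norm_power_le that) simp
    finally have "root m (norm ((q * c) ^ m)) \<le> root m (norm (q ^ m) * norm c ^ m)"
      using that by simp
    then show ?thesis
      using that by (simp add: real_root_mult real_root_power_cancel)
  qed
  have lim: "(\<lambda>m. root m (norm (q ^ m)) * norm c) \<longlonglongrightarrow> 0"
    using tendsto_mult_left_zero[of "\<lambda>m. root m (norm (q ^ m))" sequentially "norm c"] q
    by (simp add: quasinilpotents_def)
  have "(\<lambda>m. root m (norm ((q * c) ^ m))) \<longlonglongrightarrow> 0"
    by (rule tendsto_sandwich[OF _ _ tendsto_const lim])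
       (use bound in \<open>auto intro!: eventually_sequentiallyI[of 1]\<close>)
  then show ?thesis
    by (simp add: quasinilpotents_def)
qed

section \<open>The inverse square root of a quasinilpotent perturbation of the unit\<close>

text \<open>
  Quasinilpotency gives \<open>norm (y ^ m) \<le> (1 / 2) ^ m\<close> for all large \<open>m\<close>, so a geometric series
  dominates every power series in \<open>y\<close> with bounded coefficients.
\<close>

lemma summable_power_series_quasinilpotent:
  fixes y :: "'a::complex_banach_algebra_1" and c :: "nat \<Rightarrow> real"
  assumes y: "y \<in> quasinilpotents" and c: "\<And>k. \<bar>c k\<bar> \<le> 1"
  shows "summable (\<lambda>k. norm (c k *\<^sub>R y ^ k))"
proof (rule summable_comparison_test_ev)
  have "eventually (\<lambda>m. root m (norm (y ^ m)) < 1 / 2) sequentially"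
    using y by (auto simp: quasinilpotents_def intro: order_tendstoD(2) simp del: less_divide_eq_numeral1)
  then show "eventually (\<lambda>m. norm (norm (c m *\<^sub>R y ^ m)) \<le> (1 / 2) ^ m) sequentially"
    using eventually_ge_at_top[of 1]
  proof eventually_elim
    case (elim m)
    have "norm (y ^ m) = root m (norm (y ^ m)) ^ m"
      using elim by simp
    also have "\<dots> \<le> (1 / 2) ^ m"
      using elim by (intro power_mono) auto
    finally show ?case
      using mult_mono[OF c[of m], of "norm (y ^ m)" "(1 / 2) ^ m"] by simp
  qed
qed (simp add: summable_geometric)

text \<open>
  The quotient of consecutive coefficients is \<open>- (k + 1 / 2) / (k + 1)\<close>, of absolute value below \<open>1\<close>.
\<close>

lemma abs_gbinomial_minus_half_le_1: "\<bar>(- 1 / 2 :: real) gchoose k\<bar> \<le> 1"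
proof (induction k)
  case (Suc k)
  have "(- 1 / 2 :: real) gchoose Suc k = (- 1 / 2 gchoose k) * ((- 1 / 2 - real k) / real (Suc k))"
    using gbinomial_mult_1[of "- 1 / 2 :: real" k] by (simp add: field_simps)
  moreover have "\<bar>(- 1 / 2 - real k) / real (Suc k)\<bar> \<le> 1"
    by (simp add: abs_if field_simps)
  ultimately show ?case
    using mult_mono[OF Suc.IH, of "\<bar>(- 1 / 2 - real k) / real (Suc k)\<bar>" 1] by (simp add: abs_mult)
qed simp

text \<open>
  Vandermonde's identity for \<open>(1 + t) powr (- 1 / 2) * (1 + t) powr (- 1 / 2) = 1 / (1 + t)\<close>,
  read off coefficientwise.
\<close>

lemma gbinomial_minus_half_convolution:
  "(\<Sum>i\<le>k. ((- 1 / 2 :: real) gchoose i) * (- 1 / 2 gchoose (k - i))) = (- 1) ^ k"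
proof -
  have "(\<Sum>i\<le>k. ((- 1 / 2 :: real) gchoose i) * (- 1 / 2 gchoose (k - i))) = (- 1 / 2 + - 1 / 2) gchoose k"
    using gbinomial_Vandermonde[of "- 1 / 2 :: real" "- 1 / 2" k] by (simp add: atMost_atLeast0)
  also have "(- 1 / 2 + - 1 / 2 :: real) = - 1" by simp
  also have "(- 1 :: real) gchoose k = (- 1) ^ k"
    using gbinomial_minus[of "1::real" k] by (simp add: binomial_gbinomial[symmetric])
  finally show ?thesis .
qed

text \<open>
  Here \<open>1 + y * g\<close> is the binomial series of \<open>(1 + y) powr (- 1 / 2)\<close>. The factor \<open>y\<close> is split off
  so that the deviation from \<open>1\<close> is visibly a quasinilpotent. The Cauchy product of the series with
  itself is the geometric series of \<open>- y\<close>, which inverts \<open>1 + y\<close>. The first property says that \<open>g\<close>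
  lies in the double commutant of \<open>y\<close>. The lemma also shows that \<open>1 + y\<close> has a left inverse.
\<close>

lemma quasinilpotent_inverse_sqrt:
  fixes y :: "'a::complex_banach_algebra_1"
  assumes y: "y \<in> quasinilpotents"
  obtains g where "\<And>z. z * y = y * z \<Longrightarrow> z * g = g * z"
    and "(1 + y * g) * (1 + y * g) * (1 + y) = 1"
proof -
  define c :: "nat \<Rightarrow> real" where "c k = - 1 / 2 gchoose k" for k
  define g where "g = (\<Sum>k. c (Suc k) *\<^sub>R y ^ k)"
  define h where "h = (\<Sum>k. (- 1) ^ k *\<^sub>R y ^ k)"
  have c_le: "\<bar>c k\<bar> \<le> 1" for k
    unfolding c_def by (rule abs_gbinomial_minus_half_le_1)
  note abs_summable = summable_power_series_quasinilpotent[OF y]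
  note summable = summable_norm_cancel[OF abs_summable]
  have summable_g: "summable (\<lambda>k. c (Suc k) *\<^sub>R y ^ k)"
    using summable[of "\<lambda>k. c (Suc k)"] c_le by blast
  have abs_summable_w: "summable (\<lambda>k. norm (c k *\<^sub>R y ^ k))"
    using abs_summable c_le by blast
  have summable_h: "summable (\<lambda>k. (- 1) ^ k *\<^sub>R y ^ k)"
    using summable[of "\<lambda>k. (- 1) ^ k"] by (simp add: power_abs)

  have g_comm: "z * g = g * z" if "z * y = y * z" for z
  proof -
    have "z * g = (\<Sum>k. z * (c (Suc k) *\<^sub>R y ^ k))"
      unfolding g_def by (rule suminf_mult[OF summable_g, symmetric])
    also have "\<dots> = (\<Sum>k. c (Suc k) *\<^sub>R y ^ k * z)"
      using power_commuting_commutes[OF that[symmetric]] by simp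
    also have "\<dots> = g * z"
      unfolding g_def by (rule suminf_mult2[OF summable_g, symmetric])
    finally show ?thesis .
  qed

  have "(\<Sum>k. c k *\<^sub>R y ^ k) = 1 + (\<Sum>k. y * (c (Suc k) *\<^sub>R y ^ k))"
    using suminf_split_head[OF summable_norm_cancel[OF abs_summable_w]]
    by (simp add: c_def)
  also have "(\<Sum>k. y * (c (Suc k) *\<^sub>R y ^ k)) = y * g"
    unfolding g_def by (rule suminf_mult[OF summable_g])
  finally have w: "(\<Sum>k. c k *\<^sub>R y ^ k) = 1 + y * g" .
  have "(\<Sum>i\<le>k. (c i *\<^sub>R y ^ i) * (c (k - i) *\<^sub>R y ^ (k - i))) = (- 1) ^ k *\<^sub>R y ^ k" for k
  proof -
    have "(\<Sum>i\<le>k. (c i *\<^sub>R y ^ i) * (c (k - i) *\<^sub>R y ^ (k - i))) = (\<Sum>i\<le>k. (c i * c (k - i)) *\<^sub>R y ^ k)"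
      by (intro sum.cong refl) (simp add: power_add[symmetric] mult.commute)
    also have "\<dots> = (- 1) ^ k *\<^sub>R y ^ k"
      using gbinomial_minus_half_convolution[of k]
      by (simp add: c_def scaleR_sum_left[symmetric])
    finally show ?thesis .
  qed
  then have w_square: "(1 + y * g) * (1 + y * g) = h"
    using Cauchy_product[OF abs_summable_w abs_summable_w] unfolding w h_def by simp

  have "h = 1 + (\<Sum>k. (- 1) ^ k *\<^sub>R y ^ k * (- y))"
    using suminf_split_head[OF summable_h] unfolding h_def
    by (simp add: power_commutes)
  also have "(\<Sum>k. (- 1) ^ k *\<^sub>R y ^ k * (- y)) = h * (- y)"
    unfolding h_def by (rule suminf_mult2[OF summable_h, symmetric])
  finally have "h * (1 + y) = 1"
    by (simp add: algebra_simps)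
  with g_comm w_square show thesis
    by (intro that[of g]) auto
qed

section \<open>Lifting an idempotent modulo quasinilpotents\<close>

text \<open>
  The idempotent is \<open>p = (1 + u * w) / 2\<close> with \<open>u = 2 b - 1\<close> and \<open>w\<close> the inverse square root of
  \<open>u\<^sup>2\<close>: it is idempotent because \<open>u * w\<close> squares to \<open>1\<close>, and
  \<open>b - p = u * (1 - w) / 2\<close> is a multiple of \<open>y = u\<^sup>2 - 1\<close> by a commuting factor.
\<close>

lemma idempotent_near_quasinilpotent_idempotent:
  fixes b :: "'a::complex_banach_algebra_1"
  assumes b: "b - b * b \<in> quasinilpotents"
  obtains p where "p * p = p" and "b - p \<in> quasinilpotents"
    and "\<And>z. z * b = b * z \<Longrightarrow> z * p = p * z"
proof -
  define u where "u = 2 *\<^sub>R b - 1"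
  define y where "y = (- 4) *\<^sub>R (b - b * b)"
  have "y = (b - b * b) * ((- 4) *\<^sub>R 1)"
    by (simp add: y_def)
  also have "\<dots> \<in> quasinilpotents"
    using b by (intro quasinilpotents_mult_commuting) simp_all
  finally have y: "y \<in> quasinilpotents" .
  obtain g where g_comm: "\<And>z. z * y = y * z \<Longrightarrow> z * g = g * z"
    and inverse_sqrt: "(1 + y * g) * (1 + y * g) * (1 + y) = 1"
    using quasinilpotent_inverse_sqrt[OF y] by blast
  define w where "w = 1 + y * g"
  define p where "p = (1 / 2) *\<^sub>R (1 + u * w)"

  have y_comm: "z * y = y * z" if "z * b = b * z" for z
  proof -
    have "z * (b * b) = b * b * z"
      by (rule commutes_with_mult) (rule that)+
    with that show ?thesis
      by (simp add: y_def algebra_simps)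
  qed
  have w_comm: "z * w = w * z" if "z * b = b * z" for z
  proof -
    have "z * (y * g) = y * g * z"
      by (intro commutes_with_mult g_comm y_comm that)
    then show ?thesis
      by (simp add: w_def algebra_simps)
  qed
  have u_comm: "z * u = u * z" if "z * b = b * z" for z
    using that by (simp add: u_def algebra_simps)
  have p_comm: "z * p = p * z" if "z * b = b * z" for z
  proof -
    have "z * (u * w) = u * w * z"
      by (intro commutes_with_mult u_comm w_comm that)
    then show ?thesis
      by (simp add: p_def algebra_simps)
  qed

  have u_b: "u * b = b * u"
    by (rule u_comm[symmetric]) simp
  have "u * u = 4 *\<^sub>R (b * b) - 2 *\<^sub>R b - 2 *\<^sub>R b + 1"
    by (simp add: u_def algebra_simps)
  also have "\<dots> = 1 + y"
    by (simp add: y_def algebra_simps flip: scaleR_add_left)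
  finally have u_square: "u * u = 1 + y" .
  have "(u * w) * (u * w) = (w * u) * (w * u)"
    by (simp only: w_comm[OF u_b])
  also have "\<dots> = w * (u * w) * u"
    by (simp only: mult.assoc)
  also have "\<dots> = w * w * (u * u)"
    unfolding w_comm[OF u_b] by (simp add: mult.assoc)
  also have "\<dots> = 1"
    using inverse_sqrt by (simp add: u_square w_def)
  finally have involution: "(u * w) * (u * w) = 1" .
  have "p * p = (1 / 4) *\<^sub>R (1 + u * w + u * w + (u * w) * (u * w))"
    unfolding p_def by (simp add: distrib_left distrib_right add.assoc flip: scaleR_add_right)
  also have "\<dots> = (1 / 4) *\<^sub>R (2 *\<^sub>R (1 + u * w))"
    unfolding involution scaleR_2 by (simp add: algebra_simps)
  also have "\<dots> = p"
    by (simp add: p_def)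
  finally have idem: "p * p = p" .

  have "b - p = (1 / 2) *\<^sub>R (u - u * w)"
    by (simp add: p_def u_def algebra_simps flip: scaleR_add_left)
  also have "u - u * w = - (y * (u * g))"
    using y_comm[OF u_b] by (simp add: w_def distrib_left flip: mult.assoc)
  also have "(1 / 2) *\<^sub>R (- (y * (u * g))) = y * ((- 1 / 2) *\<^sub>R (u * g))"
    by simp
  also have "\<dots> \<in> quasinilpotents"
  proof (rule quasinilpotents_mult_commuting[OF y])
    have "y * g = g * y"
      by (rule g_comm) simp
    then have "y * (u * g) = u * g * y"
      by (intro commutes_with_mult y_comm[OF u_b, symmetric])
    then show "y * ((- 1 / 2) *\<^sub>R (u * g)) = (- 1 / 2) *\<^sub>R (u * g) * y"
      by simp
  qed
  finally show thesis
    using that idem p_comm by blast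
qed

section \<open>The characterization of generalized strong Drazin invertibility\<close>

theorem theorem2p4:
  fixes a :: "'a::complex_banach_algebra_1" and n :: nat
  assumes "n \<ge> 1"
  shows "gns_Drazin_invertible n a \<longleftrightarrow> a ^ n - a ^ (2 * n) \<in> quasinilpotents"
proof
  assume "gns_Drazin_invertible n a"
  then obtain x where x_comm: "x \<in> Comm2 a" and xax: "x * a * x = x"
    and q: "a ^ n - a * x \<in> quasinilpotents"
    by (auto simp: gns_Drazin_invertible_def)
  define p where "p = a * x"
  define q where "q = a ^ n - p"
  have ax: "x * a = a * x"
    using x_comm by (auto simp: Comm2_def Comm_def)
  have pp: "p * p = p"
    unfolding p_def by (metis xax mult.assoc)
  have "p * a = a * p"
    unfolding p_def by (intro commutes_with_mult[symmetric] ax[symmetric] refl)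
  then have "p * a ^ n = a ^ n * p"
    using power_commuting_commutes[of a p n] by simp
  then have pq: "p * q = q * p"
    by (simp add: q_def algebra_simps)
  have "a ^ n = p + q"
    by (simp add: q_def)
  then have "a ^ n - a ^ (2 * n) = (p + q) - (p + q) * (p + q)"
    by (simp add: mult_2 power_add)
  also have "\<dots> = q * (1 - p - p - q)"
    by (simp add: algebra_simps pp pq)
  also have "\<dots> \<in> quasinilpotents"
    using q pq
    by (intro quasinilpotents_mult_commuting) (simp_all add: q_def[symmetric] p_def[symmetric] algebra_simps)
  finally show "a ^ n - a ^ (2 * n) \<in> quasinilpotents" .
next
  assume *: "a ^ n - a ^ (2 * n) \<in> quasinilpotents"
  define b where "b = a ^ n"
  have "b - b * b \<in> quasinilpotents"
    using * by (simp add: b_def mult_2 power_add)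
  then obtain p where pp: "p * p = p" and q: "b - p \<in> quasinilpotents"
    and p_comm: "\<And>z. z * b = b * z \<Longrightarrow> z * p = p * z"
    using idempotent_near_quasinilpotent_idempotent by blast
  obtain g where g_comm: "\<And>z. z * (b - p) = (b - p) * z \<Longrightarrow> z * g = g * z"
    and inverse_sqrt: "(1 + (b - p) * g) * (1 + (b - p) * g) * (1 + (b - p)) = 1"
    using quasinilpotent_inverse_sqrt[OF q] by blast
  define v where "v = (1 + (b - p) * g) * (1 + (b - p) * g)"
  have v: "v * (1 + (b - p)) = 1"
    using inverse_sqrt by (simp add: v_def)
  have b_comm: "z * b = b * z" if "z * a = a * z" for z
    using power_commuting_commutes[OF that[symmetric], of n] by (simp add: b_def)
  have v_comm: "z * v = v * z" if "z * b = b * z" for z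
  proof -
    have "z * (b - p) = (b - p) * z"
      using that p_comm[OF that] by (simp add: algebra_simps)
    then have "z * ((b - p) * g) = (b - p) * g * z"
      by (intro commutes_with_mult g_comm)
    then have "z * (1 + (b - p) * g) = (1 + (b - p) * g) * z"
      by (simp add: algebra_simps)
    then show ?thesis
      unfolding v_def by (intro commutes_with_mult)
  qed
  (* v * p inverts b = a * a ^ (n - 1) on the corner of p, so moving the factor
     a ^ (n - 1) into x turns it into an inverse of a there. *)
  define x where "x = a ^ (n - 1) * (v * p)"
  have vp: "v * p * b = p"
  proof -
    have "p * b = b * p"
      by (rule p_comm[symmetric]) simp
    then have "p * b = (1 + (b - p)) * p"
      by (simp add: algebra_simps pp)
    then have "v * p * b = v * (1 + (b - p)) * p"
      by (metis mult.assoc)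
    then show ?thesis
      by (simp add: v)
  qed
  have vp_b: "b * (v * p) = v * p * b"
    by (intro commutes_with_mult v_comm p_comm refl)
  have "a * x = b * (v * p)"
    using assms unfolding x_def b_def mult.assoc[symmetric] power_Suc[symmetric] by simp
  then have ax: "a * x = p"
    by (simp add: vp_b vp)
  have x_comm: "z * x = x * z" if "z * a = a * z" for z
  proof -
    have "z * a ^ (n - 1) = a ^ (n - 1) * z"
      using power_commuting_commutes[OF that[symmetric], of "n - 1"] by simp
    moreover have "z * v = v * z" "z * p = p * z"
      using v_comm p_comm b_comm[OF that] by blast+
    ultimately show ?thesis
      unfolding x_def by (intro commutes_with_mult)
  qed
  have "x * (a * x) = x"
    unfolding ax by (simp add: x_def mult.assoc pp)
  then have "x * a * x = x"
    by (simp add: mult.assoc)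
  moreover have "x \<in> Comm2 a"
    using x_comm by (auto simp: Comm2_def Comm_def)
  ultimately show "gns_Drazin_invertible n a"
    using q unfolding gns_Drazin_invertible_def b_def[symmetric] ax[symmetric] by blast
qed

end
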